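(* Let two congruent circles (the lens circles), each of signed radius $R$ and signed curvature $A=1/R$, form a lens, and let $K$ be the Pedoe product of the two lens circles. Consider a chain of circles inscribed in this lens (every circle of the chain is tangent to both lens circles, and consecutive circles of the chain are tangent), and let $(b_n)$ be the sequence of signed curvatures of the consecutive circles of the chain. Then there are constants $\alpha,\beta$ such that for all $n$ $$b_{n+1}=\alpha\, b_n-b_{n-1}+\beta,$$ namely $$\alpha=\frac{6-2K}{1+K}=\frac{8}{1+K}-2,\qquad \beta=-\frac{8A}{1+K}.$$
   Context: A lens is the region common to the interiors of two congruent circles (converging lens; the chain lies in the common interior), or the region outside both of two congruent circles (diverging lens; the chain lies outside both). Curvatures are signed: a circle of radius $r$ has curvature $1/r$, except that a chain circle that encloses the lens circles gets negative curvature; the lens circles have radius $R>0$ in the converging case and $R<0$ (i.e. curvature $A<0$) in the diverging case. For two circles $C_1,C_2$ with signed radii $r_1,r_2$ and distance $d$ between their centers, the Pedoe product is $\langle C_1,C_2\rangle=\frac{d^2-r_1^2-r_2^2}{2r_1r_2}$ (it equals $\cos\varphi$ if the circles intersect at angle $\varphi$, and $+1$ for externally tangent circles of positive radii).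
   Formalization: The chain is additionally required not to turn back (the circles numbered n-1 and n+1 are different); without this, a sequence such as C0, C1, C0 would be a chain violating the recurrence. *)

theory Defs
  imports "HOL-Analysis.Analysis"
begin

(* The sign of the radius records which side of the curve counts as the circle's inside;
   the curve itself has radius equal to the absolute value. *)
datatype circle = Circle (center: "real^2") (srad: real)

definition curve :: "circle \<Rightarrow> (real^2) set" where
  "curve C = sphere (center C) \<bar>srad C\<bar>"

definition disc :: "circle \<Rightarrow> (real^2) set" where
  "disc C = ball (center C) \<bar>srad C\<bar>"

definition closed_disc :: "circle \<Rightarrow> (real^2) set" where
  "closed_disc C = cball (center C) \<bar>srad C\<bar>"

definition curvature :: "circle \<Rightarrow> real" where
  "curvature C = 1 / srad C"

definition pedoe :: "circle \<Rightarrow> circle \<Rightarrow> real" where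
  "pedoe C D =
     ((dist (center C) (center D))\<^sup>2 - (srad C)\<^sup>2 - (srad D)\<^sup>2) / (2 * srad C * srad D)"

definition tangent :: "circle \<Rightarrow> circle \<Rightarrow> bool" where
  "tangent C D \<longleftrightarrow> (\<exists>!x. x \<in> curve C \<inter> curve D)"

(* Converging lens for positive radius, diverging lens for negative radius. *)
definition lens :: "circle \<Rightarrow> circle \<Rightarrow> (real^2) set" where
  "lens L1 L2 =
     (if srad L1 > 0 then disc L1 \<inter> disc L2 else - (closed_disc L1 \<union> closed_disc L2))"

definition lens_circles :: "real \<Rightarrow> circle \<Rightarrow> circle \<Rightarrow> bool" where
  "lens_circles R L1 L2 \<longleftrightarrow>
     R \<noteq> 0 \<and> srad L1 = R \<and> srad L2 = R \<and> center L1 \<noteq> center L2 \<and> lens L1 L2 \<noteq> {}"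

(* A circle of negative radius encloses both lens circles, which is possible only for a
   diverging lens: then the curve, though not its disc, lies outside both of them. *)
definition inscribed :: "circle \<Rightarrow> circle \<Rightarrow> circle \<Rightarrow> bool" where
  "inscribed L1 L2 C \<longleftrightarrow>
     tangent C L1 \<and> tangent C L2 \<and>
     (srad C > 0 \<and> disc C \<subseteq> lens L1 L2 \<or>
      srad C < 0 \<and> srad L1 < 0 \<and> disc L1 \<union> disc L2 \<subseteq> disc C)"

(* I is an interval of integers, so finite, one-sided and two-sided infinite chains are all
   covered.  The last condition says that the chain does not turn back; a chain around a
   diverging lens may close up, so the circles are not required to be pairwise distinct. *)
definition is_chain :: "circle \<Rightarrow> circle \<Rightarrow> int set \<Rightarrow> (int \<Rightarrow> circle) \<Rightarrow> bool" where
  "is_chain L1 L2 I C \<longleftrightarrow>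
     (\<forall>i\<in>I. \<forall>j\<in>I. {i..j} \<subseteq> I) \<and>
     (\<forall>n\<in>I. inscribed L1 L2 (C n)) \<and>
     (\<forall>n. n \<in> I \<and> n + 1 \<in> I \<longrightarrow> tangent (C n) (C (n + 1))) \<and>
     (\<forall>n. n - 1 \<in> I \<and> n + 1 \<in> I \<longrightarrow> C (n - 1) \<noteq> C (n + 1))"

end

theory Submission
  imports Defs
begin

text \<open>
  Let \<open>2c\<close> be the distance between the centers of the lens circles.  Every inscribed circle is
  centered on the perpendicular bisector of these centers, and its coordinate \<open>y\<close> there satisfies
  \<open>y\<^sup>2 + c\<^sup>2 = (R - r)\<^sup>2\<close> in all of the lens configurations, thanks to the signs of the radii.
  Two different points of this hyperbola cannot satisfy \<open>(y - y')\<^sup>2 = (r - r')\<^sup>2\<close>, so tangent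
  chain circles satisfy \<open>(y - y')\<^sup>2 = (r + r')\<^sup>2\<close>.  Eliminating \<open>y\<close> and \<open>y'\<close> yields a symmetric
  biquadratic relation between the two curvatures, and the two neighbours of a chain circle are
  the two roots of the resulting quadratic equation; the recurrence is Vieta's formula for
  their sum.
\<close>

section \<open>Tangency in terms of centers and radii\<close>

text \<open>A unique common point must lie on the line of centers, so the distance of the centers is
  a sum or difference of the radii.\<close>

lemma spheres_unique_common_point:
  fixes p q :: "'a::real_inner"
  assumes "\<exists>!x. x \<in> sphere p r \<inter> sphere q s" and "r \<noteq> 0"
  shows "p \<noteq> q" and "(dist p q)\<^sup>2 = (r + s)\<^sup>2 \<or> (dist p q)\<^sup>2 = (r - s)\<^sup>2"
proof -
  obtain x where x: "dist p x = r" "dist q x = s"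
    and uniq: "\<And>x'. dist p x' = r \<Longrightarrow> dist q x' = s \<Longrightarrow> x' = x"
    using assms(1) by (auto simp: Ex1_def)
  show "p \<noteq> q"
  proof
    assume "p = q"
    \<comment> \<open>For concentric spheres the antipode of \<open>x\<close> would be a second
      common point.\<close>
    have "dist p (2 *\<^sub>R p - x) = r"
      using x(1) by (simp add: dist_norm scaleR_2 norm_minus_commute)
    then have "2 *\<^sub>R p - x = x"
      using uniq x unfolding \<open>p = q\<close> by metis
    then have "2 *\<^sub>R p = 2 *\<^sub>R x" by (simp add: scaleR_2 algebra_simps)
    then have "p = x" by simp
    with x(1) \<open>r \<noteq> 0\<close> show False by simp
  qed
  define u where "u = q - p"
  define v where "v = x - p"
  define t where "t = (v \<bullet> u) / (u \<bullet> u)"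
  define w where "w = (2 * t) *\<^sub>R u - v"
  have uu: "u \<bullet> u \<noteq> 0" using \<open>p \<noteq> q\<close> by (simp add: u_def)
  then have tu: "t * (u \<bullet> u) = v \<bullet> u" by (simp add: t_def)
  have wu: "w \<bullet> u = v \<bullet> u"
    using tu by (simp add: w_def inner_diff_left)
  have "w \<bullet> w = v \<bullet> v + 4 * t * (t * (u \<bullet> u) - v \<bullet> u)"
    by (simp add: w_def inner_diff_left inner_diff_right inner_commute algebra_simps)
  then have ww: "w \<bullet> w = v \<bullet> v" using tu by simp
  have "norm (w - u) = norm (v - u)"
    using ww wu by (simp add: norm_eq inner_diff_left inner_diff_right inner_commute)
  moreover have "q - (p + w) = - (w - u)" "q - x = - (v - u)" by (simp_all add: u_def v_def)
  ultimately have "dist q (p + w) = s"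
    using x(2) unfolding dist_norm by (metis norm_minus_cancel)
  moreover have "dist p (p + w) = r"
  proof -
    have "norm w = norm v" using ww by (simp add: norm_eq)
    then show ?thesis using x(1) by (simp add: dist_norm v_def norm_minus_commute)
  qed
  \<comment> \<open>The reflection of \<open>x\<close> in the line of centers is a common point as well, hence equals \<open>x\<close>.\<close>
  ultimately have "p + w = x" using uniq by blast
  then have "v + v = (2 * t) *\<^sub>R u" by (simp add: w_def v_def algebra_simps)
  then have "2 *\<^sub>R v = 2 *\<^sub>R (t *\<^sub>R u)" by (simp add: scaleR_2)
  then have vt: "v = t *\<^sub>R u" by (simp only: scaleR_cancel_left) simp
  have d: "dist p q = norm u" by (simp add: u_def dist_norm norm_minus_commute)
  have "r = \<bar>t\<bar> * norm u"
    using x(1) vt by (metis dist_commute dist_norm norm_scaleR v_def)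
  moreover have "s = \<bar>1 - t\<bar> * norm u"
  proof -
    have "q - x = (1 - t) *\<^sub>R u" using vt by (simp add: u_def v_def algebra_simps)
    then show ?thesis using x(2) by (simp add: dist_norm)
  qed
  ultimately have "norm u = r + s \<or> norm u = r - s \<or> norm u = s - r"
    by (auto simp: abs_if algebra_simps)
  then show "(dist p q)\<^sup>2 = (r + s)\<^sup>2 \<or> (dist p q)\<^sup>2 = (r - s)\<^sup>2"
    using d by (auto simp: power2_commute)
qed

text \<open>Changing the sign of a radius at most swaps the two alternatives, so they survive the
  passage from absolute values to signed radii.\<close>

lemma tangent_imp_dist:
  assumes "tangent C D" and "srad C \<noteq> 0"
  shows "center C \<noteq> center D"
    and "(dist (center C) (center D))\<^sup>2 = (srad C + srad D)\<^sup>2 \<or>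
         (dist (center C) (center D))\<^sup>2 = (srad C - srad D)\<^sup>2"
proof -
  have ex: "\<exists>!x. x \<in> sphere (center C) \<bar>srad C\<bar> \<inter> sphere (center D) \<bar>srad D\<bar>"
    using assms(1) by (simp add: tangent_def curve_def)
  show "center C \<noteq> center D"
    using spheres_unique_common_point(1)[OF ex] assms(2) by simp
  show "(dist (center C) (center D))\<^sup>2 = (srad C + srad D)\<^sup>2 \<or>
        (dist (center C) (center D))\<^sup>2 = (srad C - srad D)\<^sup>2"
    using spheres_unique_common_point(2)[OF ex] assms(2)
    by (cases "srad C < 0"; cases "srad D < 0") (auto simp: power2_sum power2_diff)
qed

text \<open>Otherwise the point dividing the segment of centers in the ratio \<open>r : s\<close>
  would lie in both balls.\<close>

lemma disjoint_balls_imp_dist_ge: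
  fixes p q :: "'a::real_normed_vector"
  assumes "ball p r \<inter> ball q s = {}" and "r > 0" and "s > 0"
  shows "r + s \<le> dist p q"
proof (rule ccontr)
  assume "\<not> r + s \<le> dist p q"
  then have lt: "dist p q < r + s" by simp
  define x where "x = p + (r / (r + s)) *\<^sub>R (q - p)"
  have "dist p x = r / (r + s) * dist p q"
    using assms by (simp add: x_def dist_norm norm_minus_commute)
  also have "\<dots> < r / (r + s) * (r + s)" using lt assms by (intro mult_strict_left_mono) auto
  also have "\<dots> = r" using assms by simp
  finally have "x \<in> ball p r" by simp
  have "q - x = (1 - r / (r + s)) *\<^sub>R (q - p)" by (simp add: x_def algebra_simps)
  also have "1 - r / (r + s) = s / (r + s)" using assms by (simp add: field_simps)
  finally have "dist q x = s / (r + s) * dist p q"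
    using assms by (simp add: dist_norm norm_minus_commute)
  also have "\<dots> < s / (r + s) * (r + s)" using lt assms by (intro mult_strict_left_mono) auto
  also have "\<dots> = s" using assms by simp
  finally have "x \<in> ball q s" by simp
  with \<open>x \<in> ball p r\<close> assms(1) show False by blast
qed

section \<open>Position of inscribed circles\<close>

text \<open>Tangency leaves two possible distances; being inside, outside or around the lens circle
  selects one of them, and the sign conventions make it the same formula each time.\<close>

lemma inscribed_imp_dist:
  assumes "inscribed L1 L2 C" and "srad L1 = R" and "srad L2 = R" and "R \<noteq> 0"
    and "L \<in> {L1, L2}"
  shows "dist (center C) (center L) = \<bar>R - srad C\<bar>"
proof -
  let ?d = "dist (center C) (center L)" and ?r = "srad C"
  have r: "?r \<noteq> 0" and "tangent C L" and L: "srad L = R"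
    using assms by (auto simp: inscribed_def)
  then have "?d\<^sup>2 = (?r + R)\<^sup>2 \<or> ?d\<^sup>2 = (?r - R)\<^sup>2"
    using tangent_imp_dist(2) by metis
  then have d: "?d = \<bar>R + ?r\<bar> \<or> ?d = \<bar>R - ?r\<bar>"
    using zero_le_dist[of "center C" "center L"] unfolding power2_eq_iff by linarith
  consider "?r > 0" "R > 0" "disc C \<subseteq> disc L" | "?r > 0" "R < 0" "disc C \<inter> disc L = {}"
    | "?r < 0" "R < 0" "disc L \<subseteq> disc C"
    using assms by (auto simp: inscribed_def lens_def disc_def closed_disc_def subset_iff
        split: if_splits) force+
  then show ?thesis
  proof cases
    case 1
    then have "?d + ?r \<le> R" by (simp add: disc_def ball_subset_ball_iff L)
    with d 1 show ?thesis by linarith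
  next
    case 2
    then have "?r - R \<le> ?d"
      using disjoint_balls_imp_dist_ge[of "center C" "?r" "center L" "- R"]
      by (simp add: disc_def L)
    with d 2 show ?thesis by linarith
  next
    case 3
    then have "?d - R \<le> - ?r"
      by (simp add: disc_def ball_subset_ball_iff L dist_commute)
    with d 3 show ?thesis by linarith
  qed
qed

text \<open>The vector \<open>e\<close> is \<open>u\<close> turned by a right angle and
  normalized.\<close>

lemma orthogonal_complement_line_2:
  fixes u :: "real^2"
  assumes "u \<noteq> 0"
  obtains e where "norm e = 1" and "\<And>z. z \<bullet> u = 0 \<Longrightarrow> z = (z \<bullet> e) *\<^sub>R e"
proof
  define f :: "real^2" where "f = vector [- u$2, u$1]"
  have ff: "f \<bullet> f = u \<bullet> u" by (simp add: f_def inner_vec_def sum_2)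
  have nz: "u \<bullet> u \<noteq> 0" using assms by simp
  then have nf: "norm f \<noteq> 0" using ff by (metis norm_eq_sqrt_inner real_sqrt_eq_zero_cancel_iff)
  then show "norm (f /\<^sub>R norm f) = 1" by simp
  fix z :: "real^2"
  assume z: "z \<bullet> u = 0"
  have "(f \<bullet> f) *\<^sub>R z = (z \<bullet> f) *\<^sub>R f"
  proof -
    have z': "z$1 * u$1 + z$2 * u$2 = 0" using z by (simp add: inner_vec_def sum_2)
    have "(u$1 * u$1 + u$2 * u$2) * z$1 = (z$2 * u$1 - z$1 * u$2) * (- u$2)"
      "(u$1 * u$1 + u$2 * u$2) * z$2 = (z$2 * u$1 - z$1 * u$2) * u$1"
      using z' by algebra+
    then show ?thesis
      by (simp add: ff vec_eq_iff forall_2 f_def inner_vec_def sum_2 algebra_simps)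
  qed
  then have "z = ((z \<bullet> f) / (f \<bullet> f)) *\<^sub>R f"
    using nz ff by (metis divide_inverse_commute scaleR_scaleR scaleR_one left_inverse)
  then show "z = (z \<bullet> (f /\<^sub>R norm f)) *\<^sub>R (f /\<^sub>R norm f)"
    by (simp add: dot_square_norm power2_eq_square divide_inverse mult_ac)
qed

section \<open>Algebra on the hyperbola\<close>

text \<open>In the coordinates \<open>(y, R - r)\<close> the last hypothesis gives a chord parallel
  to an asymptote, but such a line meets the hyperbola only once.\<close>

lemma hyperbola_same_sign_tangency:
  fixes y y' r r' c R :: real
  assumes "y\<^sup>2 + c\<^sup>2 = (R - r)\<^sup>2" and "y'\<^sup>2 + c\<^sup>2 = (R - r')\<^sup>2" and "c \<noteq> 0"
    and "(y - y')\<^sup>2 = (r - r')\<^sup>2"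
  shows "y = y'"
proof -
  have "c\<^sup>2 * (y - y')\<^sup>2 = 0"
    using assms(1,2,4) by algebra
  with \<open>c \<noteq> 0\<close> show ?thesis by simp
qed

lemma tangent_pair_curvature_relation:
  fixes y y' r r' c R :: real
  assumes "y\<^sup>2 + c\<^sup>2 = (R - r)\<^sup>2" and "y'\<^sup>2 + c\<^sup>2 = (R - r')\<^sup>2"
    and "(y - y')\<^sup>2 = (r + r')\<^sup>2" and "r \<noteq> 0" and "r' \<noteq> 0"
  shows "c\<^sup>2 * (1/r + 1/r')\<^sup>2 = 4 * R\<^sup>2 * (1/r) * (1/r') - 4 * R * (1/r + 1/r')"
proof -
  \<comment> \<open>The hypotheses give
    \<open>y * y' = (R - r) * (R - r') - c\<^sup>2 - 2 * r * r'\<close>; squaring this eliminates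
    \<open>y\<close> and \<open>y'\<close>.\<close>
  have "c\<^sup>2 * (r + r')\<^sup>2 = 4 * R\<^sup>2 * r * r' - 4 * R * r * r' * (r + r')"
    using assms(1-3) by algebra
  then have "c\<^sup>2 * ((r + r') / (r * r'))\<^sup>2 =
      (4 * R\<^sup>2 * r * r' - 4 * R * r * r' * (r + r')) / (r * r')\<^sup>2"
    by (simp add: power_divide)
  also have "\<dots> = 4 * R\<^sup>2 / (r * r') - 4 * R * ((r + r') / (r * r'))"
    using assms(4,5) by (simp add: field_simps power2_eq_square)
  also have "(r + r') / (r * r') = 1/r + 1/r'"
    using assms(4,5) by (simp add: field_simps)
  finally show ?thesis by simp
qed

lemma neighbour_curvature_sum:
  fixes y y1 y2 r r1 r2 c R :: real
  assumes h: "y\<^sup>2 + c\<^sup>2 = (R - r)\<^sup>2" and h1: "y1\<^sup>2 + c\<^sup>2 = (R - r1)\<^sup>2"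
    and h2: "y2\<^sup>2 + c\<^sup>2 = (R - r2)\<^sup>2"
    and t1: "(y - y1)\<^sup>2 = (r + r1)\<^sup>2" and t2: "(y - y2)\<^sup>2 = (r + r2)\<^sup>2"
    and nz: "r \<noteq> 0" "r1 \<noteq> 0" "r2 \<noteq> 0"
    and ne: "(y1, r1) \<noteq> (y2, r2)"
  shows "c\<^sup>2 * (1/r1 + 1/r2) = (4 * R\<^sup>2 - 2 * c\<^sup>2) * (1/r) - 4 * R"
proof (cases "r1 = r2")
  case False
  let ?b = "1/r" and ?b1 = "1/r1" and ?b2 = "1/r2"
  have "c\<^sup>2 * (?b + ?b1)\<^sup>2 = 4 * R\<^sup>2 * ?b * ?b1 - 4 * R * (?b + ?b1)"
    "c\<^sup>2 * (?b + ?b2)\<^sup>2 = 4 * R\<^sup>2 * ?b * ?b2 - 4 * R * (?b + ?b2)"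
    using tangent_pair_curvature_relation h h1 h2 t1 t2 nz by blast+
  \<comment> \<open>The difference of the two relations; cancelling \<open>?b1 - ?b2\<close> leaves
    the sum of the roots.\<close>
  then have "(?b1 - ?b2) * (c\<^sup>2 * (?b1 + ?b2) - ((4 * R\<^sup>2 - 2 * c\<^sup>2) * ?b - 4 * R)) = 0"
    by algebra
  moreover have "?b1 - ?b2 \<noteq> 0" using False nz by (simp add: field_simps)
  ultimately show ?thesis by simp
next
  \<comment> \<open>The neighbours are mirror images, \<open>y = 0\<close>, and the quadratic equation has a double root.\<close>
  case True
  then have "y1 \<noteq> y2" using ne by simp
  moreover have "(y1 - y2) * (y1 + y2) = 0" using h1 h2 True by algebra
  ultimately have y2: "y2 = - y1" "y1 \<noteq> 0" by auto
  then have "y * y1 = 0" using t1 t2 True by algebra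
  then have "y = 0" using y2 by simp
  have c: "c\<^sup>2 = (R - r)\<^sup>2" using h \<open>y = 0\<close> by simp
  have "y1\<^sup>2 = (r + r1)\<^sup>2" using t1 \<open>y = 0\<close> by simp
  then have "2 * ((R - r) * r - r1 * (R + r)) = 0"
    using h1 c by algebra
  then have e: "r1 * (R + r) = (R - r) * r" by simp
  \<comment> \<open>This is the claim multiplied by \<open>r * r1\<close>.\<close>
  have "2 * c\<^sup>2 * r = (4 * R\<^sup>2 - 2 * c\<^sup>2) * r1 - 4 * R * r * r1"
    using e c by algebra
  then have "c\<^sup>2 * (1/r1 + 1/r1) = (4 * R\<^sup>2 - 2 * c\<^sup>2) * (1/r) - 4 * R"
    using nz by (simp add: field_simps)
  then show ?thesis using True by simp
qed

section \<open>The recurrence along the chain\<close>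

theorem theorem2p3:
  fixes L1 L2 :: circle and R A K :: real
    and I :: "int set" and C :: "int \<Rightarrow> circle" and b :: "int \<Rightarrow> real"
  assumes "lens_circles R L1 L2"
    and "A = 1 / R"
    and "K = pedoe L1 L2"
    and "is_chain L1 L2 I C"
    and "\<And>n. n \<in> I \<Longrightarrow> b n = curvature (C n)"
  shows "\<exists>\<alpha> \<beta>. \<alpha> = (6 - 2 * K) / (1 + K) \<and> \<alpha> = 8 / (1 + K) - 2 \<and> \<beta> = - (8 * A / (1 + K)) \<and>
    (\<forall>n. n - 1 \<in> I \<and> n \<in> I \<and> n + 1 \<in> I \<longrightarrow> b (n + 1) = \<alpha> * b n - b (n - 1) + \<beta>)"
proof -
  have R: "R \<noteq> 0" "srad L1 = R" "srad L2 = R" and "center L1 \<noteq> center L2"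
    using assms(1) by (auto simp: lens_circles_def)
  \<comment> \<open>The midpoint of the centers becomes the origin, and \<open>c\<close> is half
    their distance.\<close>
  define m where "m = (1/2) *\<^sub>R (center L1 + center L2)"
  define u where "u = (1/2) *\<^sub>R (center L1 - center L2)"
  define c where "c = norm u"
  have cen: "center L1 = m + u" "center L2 = m - u"
    by (simp_all add: m_def u_def algebra_simps flip: scaleR_left_distrib)
  have "u \<noteq> 0" using \<open>center L1 \<noteq> center L2\<close> by (simp add: u_def)
  then have c: "c \<noteq> 0" by (simp add: c_def)
  have "dist (center L1) (center L2) = norm (2 *\<^sub>R u)"
    by (simp add: cen dist_norm scaleR_2)
  then have "dist (center L1) (center L2) = 2 * c" by (simp add: c_def)
  then have K: "1 + K = 2 * c\<^sup>2 / R\<^sup>2"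
    using R by (simp add: assms(3) pedoe_def field_simps power2_eq_square)
  then have K0: "1 + K \<noteq> 0" using c R by simp
  obtain e where e: "norm e = 1" "\<And>z. z \<bullet> u = 0 \<Longrightarrow> z = (z \<bullet> e) *\<^sub>R e"
    using orthogonal_complement_line_2[OF \<open>u \<noteq> 0\<close>] by blast
  define y where "y n = (center (C n) - m) \<bullet> e" for n
  define r where "r n = srad (C n)" for n
  have ins: "inscribed L1 L2 (C n)" if "n \<in> I" for n
    using assms(4) that by (auto simp: is_chain_def)
  have r0: "r n \<noteq> 0" if "n \<in> I" for n
    using ins[OF that] by (auto simp: inscribed_def r_def)
  have pos: "center (C n) = m + y n *\<^sub>R e" "(y n)\<^sup>2 + c\<^sup>2 = (R - r n)\<^sup>2" if "n \<in> I" for n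
  proof -
    define z where "z = center (C n) - m"
    have "norm (z - u) = \<bar>R - r n\<bar>" "norm (z + u) = \<bar>R - r n\<bar>"
      using inscribed_imp_dist[OF ins[OF that] R(2,3,1), of L1]
        inscribed_imp_dist[OF ins[OF that] R(2,3,1), of L2]
      by (simp_all add: cen dist_norm z_def r_def algebra_simps)
    then have n: "(z - u) \<bullet> (z - u) = (R - r n)\<^sup>2" "(z + u) \<bullet> (z + u) = (R - r n)\<^sup>2"
      by (simp_all add: dot_square_norm)
    \<comment> \<open>Equal distances to both lens centers put \<open>z\<close> on the perpendicular
      bisector.\<close>
    then have zu: "z \<bullet> u = 0"
      by (simp add: inner_diff_left inner_diff_right inner_add_left inner_add_right inner_commute)
    have z: "z = y n *\<^sub>R e" using e(2)[OF zu] by (simp add: y_def z_def)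
    then show "center (C n) = m + y n *\<^sub>R e" by (simp add: z_def algebra_simps)
    have "z \<bullet> z = (y n)\<^sup>2" using e(1) by (simp add: z dot_square_norm)
    moreover have "z \<bullet> z + u \<bullet> u = (R - r n)\<^sup>2"
      using n(2) zu by (simp add: inner_add_left inner_add_right inner_commute)
    ultimately show "(y n)\<^sup>2 + c\<^sup>2 = (R - r n)\<^sup>2" by (simp add: c_def dot_square_norm)
  qed
  have tan: "(y n - y (n + 1))\<^sup>2 = (r n + r (n + 1))\<^sup>2" if "n \<in> I" "n + 1 \<in> I" for n
  proof -
    have t: "tangent (C n) (C (n + 1))" using assms(4) that by (auto simp: is_chain_def)
    have "dist (center (C n)) (center (C (n + 1))) = norm ((y n - y (n + 1)) *\<^sub>R e)"
      using pos(1) that by (simp add: dist_norm algebra_simps)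
    then have d: "(dist (center (C n)) (center (C (n + 1))))\<^sup>2 = (y n - y (n + 1))\<^sup>2"
      using e(1) by simp
    have "y n \<noteq> y (n + 1)"
      using tangent_imp_dist(1)[OF t] r0 pos(1) that by (auto simp: r_def)
    \<comment> \<open>Distinct centers exclude the tangency alternative with the difference of
      signed radii.\<close>
    then have "(y n - y (n + 1))\<^sup>2 \<noteq> (r n - r (n + 1))\<^sup>2"
      using hyperbola_same_sign_tangency pos(2) that c by blast
    then show ?thesis
      using tangent_imp_dist(2)[OF t] r0 that d by (auto simp: r_def)
  qed
  have "b (n + 1) = (8 / (1 + K) - 2) * b n - b (n - 1) + - (8 * A / (1 + K))"
    if n: "n - 1 \<in> I" "n \<in> I" "n + 1 \<in> I" for n
  proof -
    have "C (n - 1) \<noteq> C (n + 1)" using assms(4) n by (auto simp: is_chain_def)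
    \<comment> \<open>A chain circle is determined by \<open>y\<close> and its signed radius, so a
      chain that does not turn back yields distinct pairs.\<close>
    then have ne: "(y (n - 1), r (n - 1)) \<noteq> (y (n + 1), r (n + 1))"
      using pos(1) n by (auto simp: r_def circle.expand)
    have t: "(y n - y (n - 1))\<^sup>2 = (r n + r (n - 1))\<^sup>2"
      using tan[of "n - 1"] n by (simp add: power2_commute add.commute)
    have "c\<^sup>2 * (b (n - 1) + b (n + 1)) = (4 * R\<^sup>2 - 2 * c\<^sup>2) * b n - 4 * R"
      using neighbour_curvature_sum[OF pos(2) pos(2) pos(2) t tan r0 r0 r0 ne] n
      by (simp add: assms(5) curvature_def r_def)
    then have "b (n - 1) + b (n + 1) = ((4 * R\<^sup>2 - 2 * c\<^sup>2) * b n - 4 * R) / c\<^sup>2"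
      using c by (simp add: eq_divide_eq mult.commute)
    also have "\<dots> = (4 * R\<^sup>2 / c\<^sup>2 - 2) * b n - 4 * R / c\<^sup>2"
      using c by (simp add: diff_divide_distrib left_diff_distrib)
    finally have "b (n - 1) + b (n + 1) = (4 * R\<^sup>2 / c\<^sup>2 - 2) * b n - 4 * R / c\<^sup>2" .
    \<comment> \<open>Since \<open>1 + K = 2 * c\<^sup>2 / R\<^sup>2\<close>, these turn the
      coefficients in \<open>c\<close> and \<open>R\<close> into those in \<open>K\<close> and
      \<open>A\<close>.\<close>
    moreover have "8 / (1 + K) = 4 * R\<^sup>2 / c\<^sup>2" "8 * A / (1 + K) = 4 * R / c\<^sup>2"
      using c R by (simp_all add: K assms(2) field_simps power2_eq_square)
    ultimately show ?thesis by simp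
  qed
  moreover have "(6 - 2 * K) / (1 + K) = 8 / (1 + K) - 2"
    using K0 by (simp add: field_simps)
  ultimately show ?thesis by auto
qed

end
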